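(* Let $F=F(N,\mathcal D)$ be a connected GSC with no cut points. Then $F$ has a local cut point if and only if there exist $n\in\{1,2\}$ and disjoint subsets $I,J\subset\mathcal D^n$ such that (1) $\big(\bigcup_{\mathbf i\in I}\varphi_{\mathbf i}(F)\big)\cap\big(\bigcup_{\mathbf i\in J}\varphi_{\mathbf i}(F)\big)$ is a singleton $\{x\}$, and (2) $I\cup J=\{\mathbf i\in\mathcal D^n: x\in\varphi_{\mathbf i}(F)\}$.
   Context: GSC: $N\ge2$, $\mathcal D\subset\{0,\dots,N-1\}^2$ with $1<|\mathcal D|<N^2$, $\varphi_i(x)=\frac1N(x+i)$, $F=F(N,\mathcal D)$ the unique nonempty compact set with $F=\bigcup_{i\in\mathcal D}\varphi_i(F)$; for a word $\mathbf i=i_1\cdots i_n\in\mathcal D^n$, $\varphi_{\mathbf i}=\varphi_{i_1}\circ\cdots\circ\varphi_{i_n}$. A cut point of a connected space $X$ is $x$ with $X\setminus\{x\}$ disconnected; a local cut point of $X$ is a point $x$ that is a cut point of some connected neighborhood of $x$ in $X$. *)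

theory Defs
  imports "HOL-Analysis.Analysis"
begin

definition gsc_map :: "nat \<Rightarrow> nat \<times> nat \<Rightarrow> real \<times> real \<Rightarrow> real \<times> real" where
  "gsc_map N i x = ((fst x + real (fst i)) / real N, (snd x + real (snd i)) / real N)"

fun gsc_word :: "nat \<Rightarrow> (nat \<times> nat) list \<Rightarrow> real \<times> real \<Rightarrow> real \<times> real" where
  "gsc_word N [] = id"
| "gsc_word N (i # is) = gsc_map N i \<circ> gsc_word N is"

definition words :: "'a set \<Rightarrow> nat \<Rightarrow> 'a list set" where
  "words D n = {w. length w = n \<and> set w \<subseteq> D}"

text \<open>Standing GSC assumptions; F is the (unique) nonempty compact attractor.\<close>
definition is_GSC :: "nat \<Rightarrow> (nat \<times> nat) set \<Rightarrow> (real \<times> real) set \<Rightarrow> bool" where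
  "is_GSC N D F \<longleftrightarrow> N \<ge> 2 \<and> D \<subseteq> {0..<N} \<times> {0..<N} \<and> 1 < card D \<and> card D < N ^ 2
     \<and> compact F \<and> F \<noteq> {} \<and> F = (\<Union>i\<in>D. gsc_map N i ` F)"

definition cut_point :: "'a::topological_space set \<Rightarrow> 'a \<Rightarrow> bool" where
  "cut_point X x \<longleftrightarrow> connected X \<and> x \<in> X \<and> \<not> connected (X - {x})"

definition local_cut_point :: "'a::topological_space set \<Rightarrow> 'a \<Rightarrow> bool" where
  "local_cut_point X x \<longleftrightarrow> x \<in> X \<and> (\<exists>U V. U \<subseteq> X \<and> open V \<and> x \<in> V \<and> V \<inter> X \<subseteq> U
       \<and> connected U \<and> cut_point U x)"

end

(* Level-n cells, rescaled by N^n, are translates p + F of F by integer points, so how two of them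
   meet depends only on the difference of their positions, not on n.  Near a local cut point x the
   cells containing x are connected even without x, so they split into two classes, and cells of
   different classes meet only in x.  Such a splitting at some level n >= 3 gives one at a lower
   level: if N^n x lies in N Z^2, dropping the last letter of all words keeps the differences of
   positions; otherwise all cells share the row (or column) of their level n-1 parents, and either
   all words share their first letter, which can be dropped, or keeping only the first and last
   letters reproduces the same arrangement of cells at level 2. *)
theory Submission
  imports Defs
begin

section \<open>Integer positions and the abstract setting\<close>

definition emb :: "int \<times> int \<Rightarrow> real \<times> real" where
  "emb p = (of_int (fst p), of_int (snd p))"

definition pdiv :: "int \<times> int \<Rightarrow> int \<Rightarrow> int \<times> int" where
  "pdiv z k = (fst z div k, snd z div k)"

definition pmod :: "int \<times> int \<Rightarrow> int \<Rightarrow> int \<times> int" where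
  "pmod z k = (fst z mod k, snd z mod k)"

lemma emb_simps [simp]: "fst (emb p) = of_int (fst p)" "snd (emb p) = of_int (snd p)"
  by (simp_all add: emb_def)

lemma emb_add: "emb (p + q) = emb p + emb q" and emb_diff: "emb (p - q) = emb p - emb q"
  by (simp_all add: prod_eq_iff)

lemma of_int_mod: "real_of_int (a mod b) = of_int a - of_int b * of_int (a div b)"
  by (simp add: minus_mult_div_eq_mod [symmetric])

text \<open>The similarity with digit \<open>d\<close> has the inverse \<open>x\<close> to
  \<open>N x - d\<close>, so \<open>F_iff\<close> is the self-similarity of \<open>F\<close>
  expressed through membership. As a locale it can be instantiated a second time with the reflected
  \<open>D\<close> and \<open>F\<close>.\<close>

locale carpet =
  fixes N :: int and D :: "(int \<times> int) set" and F :: "(real \<times> real) set"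
  assumes N_ge_2: "N \<ge> 2"
    and D_sub: "D \<subseteq> {0..<N} \<times> {0..<N}"
    and F_sub: "F \<subseteq> {0..1} \<times> {0..1}"
    and F_iff: "x \<in> F \<longleftrightarrow> (\<exists>d\<in>D. of_int N *\<^sub>R x - emb d \<in> F)"
begin

text \<open>Positions of the level \<open>n\<close> cells: pairs of base \<open>N\<close> numerals
  whose digit pairs are the letters of a word over \<open>D\<close>. The recursion strips the last
  letter.\<close>

primrec digs :: "nat \<Rightarrow> (int \<times> int) set" where
  "digs 0 = {0}"
| "digs (Suc n) = {z. pdiv z N \<in> digs n \<and> pmod z N \<in> D}"

text \<open>Everything at level \<open>n\<close> is rescaled by \<open>N ^ n\<close>, so that the cells become the integer
  translates \<open>emb p + F\<close>.\<close>

definition around :: "nat \<Rightarrow> real \<times> real \<Rightarrow> (int \<times> int) set" where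
  "around n X = {p \<in> digs n. X - emb p \<in> F}"

text \<open>This bounds the intersection of \<open>F\<close> with its translate by \<open>d\<close>.
  No level enters, so the property survives a change of level.\<close>

definition thin :: "int \<times> int \<Rightarrow> bool" where
  "thin d \<longleftrightarrow> (\<forall>z z'. z \<in> F \<and> z - emb d \<in> F \<and> z' \<in> F \<and> z' - emb d \<in> F \<longrightarrow> z = z')"

text \<open>All cells of \<open>around n X\<close> contain \<open>X\<close>. Hence nonempty classes
  with thin cross pairs have unions that meet in \<open>X\<close> and nowhere else, which is
  condition (1); the first conjunct is condition (2).\<close>

definition splitting :: "nat \<Rightarrow> real \<times> real \<Rightarrow> (int \<times> int) set \<Rightarrow> (int \<times> int) set \<Rightarrow> bool" where
  "splitting n X I J \<longleftrightarrow> I \<union> J = around n X \<and> I \<inter> J = {} \<and> I \<noteq> {} \<and> J \<noteq> {}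
     \<and> (\<forall>w\<in>I. \<forall>v\<in>J. thin (v - w))"

section \<open>Digits of positions, and membership in \<open>F\<close> level by level\<close>

lemma D_bounds: "d \<in> D \<Longrightarrow> 0 \<le> fst d \<and> fst d < N \<and> 0 \<le> snd d \<and> snd d < N"
  using D_sub by auto

lemma F_bounds: "x \<in> F \<Longrightarrow> 0 \<le> fst x \<and> fst x \<le> 1 \<and> 0 \<le> snd x \<and> snd x \<le> 1"
  using F_sub by auto

lemma digs_1: "digs 1 = D"
proof -
  have "pdiv z N = 0 \<and> pmod z N \<in> D \<longleftrightarrow> z \<in> D" for z
  proof
    assume a: "pdiv z N = 0 \<and> pmod z N \<in> D"
    hence "fst z div N = 0" "snd z div N = 0" by (simp_all add: pdiv_def prod_eq_iff)
    hence "z = pmod z N"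
      using div_mult_mod_eq[of "fst z" N] div_mult_mod_eq[of "snd z" N]
      by (simp add: pmod_def prod_eq_iff)
    thus "z \<in> D" using a by simp
  next
    assume "z \<in> D"
    with D_bounds[OF this] show "pdiv z N = 0 \<and> pmod z N \<in> D"
      by (simp add: pdiv_def pmod_def prod_eq_iff)
  qed
  thus ?thesis by auto
qed

text \<open>The definition of \<open>digs\<close> removes the last letter of a word; this is the
  reading from the other end, with the first letter as leading base \<open>N\<close> digit. Level
  reductions drop letters at either end.\<close>

lemma digs_Suc_front: "z \<in> digs (Suc m) \<longleftrightarrow> pdiv z (N ^ m) \<in> D \<and> pmod z (N ^ m) \<in> digs m"
proof (induction m arbitrary: z)
  case 0
  show ?case using digs_1 by (simp add: pdiv_def pmod_def zero_prod_def)
next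
  case (Suc m)
  have d: "pdiv (pdiv z N) (N ^ m) = pdiv z (N ^ Suc m)"
    using N_ge_2 by (simp add: pdiv_def zdiv_zmult2_eq)
  have *: "(a mod (N * N ^ m)) div N = (a div N) mod N ^ m" for a
    using N_ge_2 by (simp add: zmod_zmult2_eq)
  have e: "pmod (pdiv z N) (N ^ m) = pdiv (pmod z (N ^ Suc m)) N"
    using * by (simp add: pdiv_def pmod_def)
  have f: "pmod (pmod z (N ^ Suc m)) N = pmod z N"
    by (simp add: pmod_def mod_mod_cancel)
  have "z \<in> digs (Suc (Suc m)) \<longleftrightarrow> pdiv z N \<in> digs (Suc m) \<and> pmod z N \<in> D" by simp
  also have "\<dots> \<longleftrightarrow> pdiv z (N ^ Suc m) \<in> D \<and> pdiv (pmod z (N ^ Suc m)) N \<in> digs m \<and> pmod z N \<in> D"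
    unfolding Suc.IH d e by blast
  also have "\<dots> \<longleftrightarrow> pdiv z (N ^ Suc m) \<in> D \<and> pmod z (N ^ Suc m) \<in> digs (Suc m)"
    using f by simp
  finally show ?case .
qed

lemma digs_bounds:
  "p \<in> digs m \<Longrightarrow> 0 \<le> fst p \<and> fst p < N ^ m \<and> 0 \<le> snd p \<and> snd p < N ^ m"
proof (induction m arbitrary: p)
  case 0
  then show ?case by simp
next
  case (Suc m)
  have *: "0 \<le> a \<and> a < N ^ Suc m" if "0 \<le> a div N" "a div N < N ^ m" for a
  proof -
    have "0 \<le> a" using that N_ge_2 by (simp add: pos_imp_zdiv_nonneg_iff)
    moreover have "N * (a div N + 1) \<le> N * N ^ m"
      using that N_ge_2 by (intro mult_left_mono) auto
    moreover have "a < N * (a div N + 1)"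
    proof -
      have "a mod N < N" using N_ge_2 by simp
      with mult_div_mod_eq[of N a] show ?thesis unfolding distrib_left by linarith
    qed
    ultimately show ?thesis by simp
  qed
  have "pdiv p N \<in> digs m" using Suc.prems by simp
  from Suc.IH[OF this] show ?case using *[of "fst p"] *[of "snd p"] by (simp add: pdiv_def)
qed

text \<open>This is \<open>F_iff\<close> iterated: each step appends a digit \<open>d\<close> to the
  position \<open>p\<close> found so far, giving \<open>N * p + d\<close>.\<close>

lemma mem_scaled:
  assumes "x \<in> F" shows "\<exists>p\<in>digs n. of_int (N ^ n) *\<^sub>R x - emb p \<in> F"
proof (induction n)
  case 0
  show ?case using assms by (simp add: emb_def zero_prod_def [symmetric])
next
  case (Suc n)
  then obtain p where p: "p \<in> digs n" "of_int (N ^ n) *\<^sub>R x - emb p \<in> F" by blast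
  then obtain d where d: "d \<in> D" "of_int N *\<^sub>R (of_int (N ^ n) *\<^sub>R x - emb p) - emb d \<in> F"
    using F_iff by blast
  let ?z = "(N * fst p + fst d, N * snd p + snd d)"
  have "pdiv ?z N = p" "pmod ?z N = d"
    using D_bounds[OF d(1)] by (simp_all add: pdiv_def pmod_def)
  hence "?z \<in> digs (Suc n)" using p d by simp
  moreover have "of_int (N ^ Suc n) *\<^sub>R x - emb ?z =
      of_int N *\<^sub>R (of_int (N ^ n) *\<^sub>R x - emb p) - emb d"
    by (simp add: prod_eq_iff algebra_simps)
  ultimately show ?case using d(2) by metis
qed

lemma scaled_mem:
  assumes "p \<in> digs n" "of_int (N ^ n) *\<^sub>R x - emb p \<in> F" shows "x \<in> F"
  using assms
proof (induction n arbitrary: p)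
  case 0
  then show ?case by (simp add: emb_def zero_prod_def [symmetric])
next
  case (Suc n)
  have "of_int (N ^ Suc n) *\<^sub>R x - emb p =
      of_int N *\<^sub>R (of_int (N ^ n) *\<^sub>R x - emb (pdiv p N)) - emb (pmod p N)"
    by (simp add: prod_eq_iff algebra_simps pdiv_def pmod_def of_int_mod)
  hence "of_int (N ^ n) *\<^sub>R x - emb (pdiv p N) \<in> F"
    using Suc.prems F_iff[of "of_int (N ^ n) *\<^sub>R x - emb (pdiv p N)"] by auto
  moreover have "pdiv p N \<in> digs n" using Suc.prems by simp
  ultimately show ?case by (rule Suc.IH[rotated])
qed

section \<open>Lowering the level of a splitting\<close>

lemma around_bounds:
  "p \<in> around n X \<Longrightarrow> of_int (fst p) \<le> fst X \<and> fst X \<le> of_int (fst p) + 1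
     \<and> of_int (snd p) \<le> snd X \<and> snd X \<le> of_int (snd p) + 1"
  using F_bounds[of "X - emb p"] by (auto simp: around_def algebra_simps)

text \<open>A cell contains a point iff one of its children does, so the cells at the point one
  level up are the parents of the cells at that point.\<close>

lemma around_truncate: "around n ((1 / of_int N) *\<^sub>R X) = (\<lambda>z. pdiv z N) ` around (Suc n) X"
proof -
  have sc: "of_int N *\<^sub>R ((1 / of_int N) *\<^sub>R X - emb p) = X - of_int N *\<^sub>R emb p" for p
    using N_ge_2 by (simp add: scaleR_right_diff_distrib)
  show ?thesis
  proof (intro equalityI subsetI)
    fix p assume p: "p \<in> around n ((1 / of_int N) *\<^sub>R X)"
    then obtain d where d: "d \<in> D" "of_int N *\<^sub>R ((1 / of_int N) *\<^sub>R X - emb p) - emb d \<in> F"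
      unfolding around_def using F_iff[of "(1 / of_int N) *\<^sub>R X - emb p"] by blast
    let ?z = "(N * fst p + fst d, N * snd p + snd d)"
    have pd: "pdiv ?z N = p" "pmod ?z N = d"
      using D_bounds[OF d(1)] by (simp_all add: pdiv_def pmod_def)
    have "X - emb ?z = of_int N *\<^sub>R ((1 / of_int N) *\<^sub>R X - emb p) - emb d"
      unfolding sc by (simp add: prod_eq_iff)
    hence "?z \<in> around (Suc n) X" using p pd d by (auto simp: around_def)
    thus "p \<in> (\<lambda>z. pdiv z N) ` around (Suc n) X" using pd(1) by (metis image_eqI)
  next
    fix p assume "p \<in> (\<lambda>z. pdiv z N) ` around (Suc n) X"
    then obtain z where z: "p = pdiv z N" "z \<in> digs (Suc n)" "X - emb z \<in> F"
      by (auto simp: around_def)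
    have "X - emb z = of_int N *\<^sub>R ((1 / of_int N) *\<^sub>R X - emb p) - emb (pmod z N)"
      unfolding sc z(1) by (simp add: prod_eq_iff pdiv_def pmod_def of_int_mod)
    thus "p \<in> around n ((1 / of_int N) *\<^sub>R X)"
      using z F_iff[of "(1 / of_int N) *\<^sub>R X - emb p"] by (auto simp: around_def)
  qed
qed

text \<open>Thinness sees only the differences \<open>v - w\<close>, so a translation matching two
  arrangements of cells carries the splitting along, even between different levels.\<close>

lemma splitting_translate:
  assumes "splitting n X I J" "around k (X + emb t) = (\<lambda>z. z + t) ` around n X"
  shows "splitting k (X + emb t) ((\<lambda>z. z + t) ` I) ((\<lambda>z. z + t) ` J)"
  using assms unfolding splitting_def by (auto simp: image_Un)

text \<open>Equal parents of \<open>w\<close> and \<open>v\<close> would give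
  \<open>v - w = 0\<close>, against disjointness, so the classes of parents stay disjoint; thinness
  carries over because the cross differences are unchanged.\<close>

lemma splitting_truncate:
  assumes sp: "splitting (Suc n) X I J"
    and cross: "\<And>w v. w \<in> I \<Longrightarrow> v \<in> J \<Longrightarrow> pdiv v N - pdiv w N = v - w"
  shows "\<exists>Y I' J'. splitting n Y I' J'"
proof -
  have "pdiv w N \<noteq> pdiv v N" if "w \<in> I" "v \<in> J" for w v
    using cross[OF that] sp that by (auto simp: splitting_def)
  hence "splitting n ((1 / of_int N) *\<^sub>R X) ((\<lambda>z. pdiv z N) ` I) ((\<lambda>z. pdiv z N) ` J)"
    using sp cross unfolding splitting_def around_truncate
    by (simp add: image_Un [symmetric] disjoint_iff) (metis imageE)
  thus ?thesis by blast
qed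

text \<open>The common first letter \<open>a\<close> contributes \<open>N ^ m * a\<close> to every
  position; translating by the negative of this deletes the letter.\<close>

lemma splitting_peel:
  assumes sp: "splitting (Suc m) X I J"
    and same: "\<And>z. z \<in> around (Suc m) X \<Longrightarrow> pdiv z (N ^ m) = a"
  shows "\<exists>Y I' J'. splitting m Y I' J'"
proof -
  obtain z0 where z0: "z0 \<in> around (Suc m) X" using sp by (auto simp: splitting_def)
  hence aD: "a \<in> D" using same[OF z0] digs_Suc_front[of z0 m]
    by (simp add: around_def del: digs.simps)
  define t where "t = (- (N ^ m * fst a), - (N ^ m * snd a))"
  have "around m (X + emb t) = (\<lambda>z. z + t) ` around (Suc m) X"
  proof (intro equalityI subsetI)
    fix p assume p: "p \<in> around m (X + emb t)"
    hence b: "0 \<le> fst p \<and> fst p < N ^ m \<and> 0 \<le> snd p \<and> snd p < N ^ m"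
      using digs_bounds[of p m] by (simp add: around_def)
    have "pdiv (p - t) (N ^ m) = a" "pmod (p - t) (N ^ m) = p"
      using b N_ge_2 by (simp_all add: pdiv_def pmod_def t_def prod_eq_iff)
    hence "p - t \<in> digs (Suc m)" using p aD digs_Suc_front[of "p - t" m] by (simp add: around_def del: digs.simps)
    moreover have "X - emb (p - t) \<in> F" using p by (simp add: around_def emb_diff algebra_simps)
    ultimately have "p - t \<in> around (Suc m) X" by (simp add: around_def del: digs.simps)
    thus "p \<in> (\<lambda>z. z + t) ` around (Suc m) X" by (metis diff_add_cancel image_eqI)
  next
    fix p assume "p \<in> (\<lambda>z. z + t) ` around (Suc m) X"
    then obtain z where z: "z \<in> around (Suc m) X" "p = z + t" by blast
    have "pdiv z (N ^ m) = a" using same z by simp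
    hence "p = pmod z (N ^ m)"
      using z(2) mult_div_mod_eq[of "N ^ m" "fst z"] mult_div_mod_eq[of "N ^ m" "snd z"]
      by (auto simp: pdiv_def pmod_def t_def prod_eq_iff)
    hence "p \<in> digs m" using z digs_Suc_front[of z m] by (simp add: around_def del: digs.simps)
    moreover have "X + emb t - emb p \<in> F"
      using z by (simp add: around_def emb_add algebra_simps)
    ultimately show "p \<in> around m (X + emb t)" by (simp add: around_def)
  qed
  from splitting_translate[OF sp this] show ?thesis by blast
qed

text \<open>If \<open>b\<close> and \<open>c\<close> differ, they are neighbours and
  \<open>y\<close> is the larger one. Their quotients could differ only if that larger one were a
  multiple of \<open>N\<close>.\<close>

lemma div_row_const:
  fixes y :: real
  assumes "\<nexists>j. y = of_int (N * j)" "of_int b \<le> y" "y \<le> of_int b + 1" "of_int c \<le> y" "y \<le> of_int c + 1"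
  shows "b div N = c div N"
proof -
  have *: "b div N = c div N"
    if h: "of_int b \<le> y" "y \<le> of_int b + 1" "of_int c \<le> y" "y \<le> of_int c + 1" "b \<le> c" for b c
  proof (cases "b = c")
    case False
    have "real_of_int c \<le> of_int b + 1" using h by linarith
    hence c: "c = b + 1" using False \<open>b \<le> c\<close> by linarith
    hence y: "y = of_int c" using h by auto
    hence "\<not> N dvd c" using assms(1) by (auto simp: dvd_def)
    hence "c mod N \<noteq> 0" by auto
    moreover have "0 \<le> c mod N" "c mod N < N" using N_ge_2 by auto
    moreover have "b = N * (c div N) + (c mod N - 1)" using c mult_div_mod_eq[of N c] by linarith
    ultimately show ?thesis
      using int_div_pos_eq[of b N "c div N" "c mod N - 1"] by simp
  qed simp
  show ?thesis using *[of b c] *[of c b] assms by linarith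
qed

text \<open>The parents of all cells at \<open>X\<close> lie in one row.  If the words have no common first letter, then
  \<open>X\<close> is on the edge between two horizontally adjacent parents \<open>(k, l)\<close> and \<open>(k - 1, l)\<close>, with first
  letters \<open>(A, B)\<close> and \<open>(A - 1, B)\<close>; replacing the parents by these letters is a translation.\<close>
lemma splitting_reduce_row:
  assumes sp: "splitting (Suc (Suc m)) X I J" and m: "m \<ge> 1"
    and row: "\<nexists>j. snd X = of_int (N * j)"
  shows "\<exists>n Y I' J'. n \<in> {2, Suc m} \<and> splitting n Y I' J'"
proof (rule ccontr)
  let ?W = "around (Suc (Suc m)) X"
  assume no: "\<not> ?thesis"
  \<comment> \<open>A first letter common to all cells would let \<open>splitting_peel\<close> reach
    level \<open>Suc m\<close>.\<close>
  have nopeel: "\<exists>z\<in>?W. pdiv z (N ^ Suc m) \<noteq> a" for a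
    using splitting_peel[OF sp, of a] no by blast
  have dd: "pdiv z (N ^ Suc m) = pdiv (pdiv z N) (N ^ m)" for z
    using N_ge_2 by (simp add: pdiv_def zdiv_zmult2_eq)
  have dW: "pdiv z N \<in> digs (Suc m)" "pmod z N \<in> D" if "z \<in> ?W" for z
    using that by (auto simp: around_def)
  obtain z0 where z0: "z0 \<in> ?W" using nopeel by blast
  define l where "l = snd z0 div N"
  have row': "snd z div N = l" if "z \<in> ?W" for z
    unfolding l_def using around_bounds[OF that] around_bounds[OF z0] row
    by (intro div_row_const[of "snd X"]) auto
  obtain z1 where z1: "z1 \<in> ?W" "fst z1 div N \<noteq> fst z0 div N"
  proof -
    obtain z1 where "z1 \<in> ?W" "pdiv z1 (N ^ Suc m) \<noteq> pdiv z0 (N ^ Suc m)" using nopeel by blast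
    with row'[OF this(1)] row'[OF z0] have "fst z1 div N \<noteq> fst z0 div N"
      unfolding dd by (auto simp: pdiv_def)
    thus ?thesis using that \<open>z1 \<in> ?W\<close> by blast
  qed
  \<comment> \<open>The contrapositive of \<open>div_row_const\<close> in the first coordinate:
    parents in different columns force \<open>X\<close> onto the line between them.\<close>
  have "\<exists>k. fst X = of_int (N * k)"
    using div_row_const[of "fst X" "fst z1" "fst z0"] around_bounds[OF z1(1)] around_bounds[OF z0] z1(2)
    by auto
  then obtain k where k: "fst X = of_int (N * k)" by blast
  \<comment> \<open>The offset \<open>e\<close> is 0 for a cell to the right of the line
    \<open>N * i\<close> and 1 for a cell to its left; the parent column shifts by the same
    amount.\<close>
  have col: "(\<exists>e\<in>{0,1}. fst z = N * i - e \<and> fst z div N = i - e)"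
    if "real_of_int (fst z) \<le> of_int (N * i)" "of_int (N * i) \<le> real_of_int (fst z) + 1"
    for z :: "int \<times> int" and i
  proof -
    have "fst z \<le> N * i" "N * i \<le> fst z + 1" using that by linarith+
    hence "fst z = N * i \<or> fst z = N * i - 1" by linarith
    moreover have "(N * i - 1) div N = i - 1"
      using int_div_pos_eq[of "N * i - 1" N "i - 1" "N - 1"] N_ge_2 by (simp add: algebra_simps)
    ultimately show ?thesis using N_ge_2 by auto
  qed
  have col': "pdiv z N \<in> {(k, l), (k - 1, l)}" if "z \<in> ?W" for z
    using col[of z k] around_bounds[OF that] row'[OF that] unfolding k pdiv_def by auto
  have both: "(k, l) \<in> digs (Suc m)" "(k - 1, l) \<in> digs (Suc m)"
    using col'[OF z0] col'[OF z1(1)] z1(2) dW(1)[OF z0] dW(1)[OF z1(1)] by (auto simp: pdiv_def)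
  define A B where "A = k div N ^ m" and "B = l div N ^ m"
  have pos: "N ^ m > 0" using N_ge_2 by simp
  \<comment> \<open>If the parents \<open>(k, l)\<close> and \<open>(k - 1, l)\<close> had the same
    first letter, all cells would share it, against \<open>nopeel\<close>.\<close>
  have A1: "(k - 1) div N ^ m = A - 1"
  proof -
    have "(k - 1) div N ^ m \<noteq> A"
      using nopeel[of "(A, B)"] col' dd by (fastforce simp: A_def B_def pdiv_def)
    moreover have "(k - 1) div N ^ m \<le> A" using pos by (simp add: A_def zdiv_mono1)
    moreover have "A - 1 \<le> (k - 1) div N ^ m"
      using zdiv_mono1[of "k - N ^ m" "k - 1" "N ^ m"] pos
        div_add_self2[of "N ^ m" "k - N ^ m"]
      unfolding A_def by (simp del: div_add_self2 power_eq_0_iff)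
    ultimately show ?thesis by linarith
  qed
  have AB: "(A, B) \<in> D" "(A - 1, B) \<in> D"
    using both digs_Suc_front[of "(k, l)" m] digs_Suc_front[of "(k - 1, l)" m] A1
    by (simp_all add: pdiv_def A_def B_def del: digs.simps)
  \<comment> \<open>The shift \<open>s\<close> takes the parents to their first letters. Its
    multiple \<open>t\<close> by \<open>N\<close> does this to the parents while keeping all last
    letters.\<close>
  define s where "s = (A - k, B - l)"
  define t where "t = (N * fst s, N * snd s)"
  have pt: "pdiv (z + t) N = pdiv z N + s" "pmod (z + t) N = pmod z N" for z
    using N_ge_2 by (simp_all add: pdiv_def pmod_def t_def prod_eq_iff)
  have dg2: "z \<in> digs 2 \<longleftrightarrow> pdiv z N \<in> D \<and> pmod z N \<in> D" for z
    using digs_1 by (simp add: numeral_2_eq_2)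
  have "around 2 (X + emb t) = (\<lambda>z. z + t) ` ?W"
  proof (intro equalityI subsetI)
    fix p assume p: "p \<in> around 2 (X + emb t)"
    define z where "z = p - t"
    have pz: "p = z + t" by (simp add: z_def)
    have zF: "X - emb z \<in> F" using p by (simp add: around_def pz emb_add)
    hence bz: "of_int (fst z) \<le> fst X \<and> fst X \<le> of_int (fst z) + 1
        \<and> of_int (snd z) \<le> snd X \<and> snd X \<le> of_int (snd z) + 1"
      using F_bounds[OF zF] by auto
    \<comment> \<open>So far \<open>z\<close> is only the shift of a level 2 position. Its geometry
      confines its parent to the two positions of \<open>both\<close>, which makes it a position of
      the original level.\<close>
    have "snd z div N = l"
      unfolding l_def using bz around_bounds[OF z0] row
      by (intro div_row_const[of "snd X"]) auto
    hence "pdiv z N \<in> {(k, l), (k - 1, l)}"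
      using col[of z k] bz unfolding k pdiv_def by auto
    hence "pdiv z N \<in> digs (Suc m)" using both by (auto simp del: digs.simps)
    moreover have "pmod z N \<in> D" using p pt dg2 by (simp add: around_def pz)
    ultimately have "z \<in> ?W" using zF by (simp add: around_def)
    thus "p \<in> (\<lambda>z. z + t) ` ?W" using pz by blast
  next
    fix p assume "p \<in> (\<lambda>z. z + t) ` ?W"
    then obtain z where z: "z \<in> ?W" "p = z + t" by blast
    have "pdiv p N \<in> {(A, B), (A - 1, B)}"
      using col'[OF z(1)] by (auto simp: z(2) pt s_def)
    hence "p \<in> digs 2" using AB dW(2)[OF z(1)] by (auto simp: dg2 z(2) pt)
    moreover have "X + emb t - emb p \<in> F" using z by (simp add: around_def emb_add)
    ultimately show "p \<in> around 2 (X + emb t)" by (simp add: around_def)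
  qed
  from splitting_translate[OF sp this] no show False by blast
qed

lemma not_splitting_0: "\<not> splitting 0 X I J"
proof
  assume sp: "splitting 0 X I J"
  hence "I \<union> J \<subseteq> {0}" by (auto simp: splitting_def around_def)
  with sp show False unfolding splitting_def by blast
qed

lemma thin_scaled:
  assumes "X - emb w \<in> F" "X - emb v \<in> F" "thin (v - w)" "Y - emb w \<in> F" "Y - emb v \<in> F"
  shows "Y = X"
proof -
  have "Y - emb w - emb (v - w) = Y - emb v" "X - emb w - emb (v - w) = X - emb v"
    by (simp_all add: emb_diff)
  hence "Y - emb w = X - emb w"
    using assms unfolding thin_def by metis
  thus ?thesis by simp
qed

end

section \<open>Reflection in the diagonal\<close>

lemma emb_swap: "emb (prod.swap p) = prod.swap (emb p)"
  by (simp add: emb_def)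

lemma swap_diff: "prod.swap (p - q) = prod.swap p - prod.swap q"
  by (simp add: prod_eq_iff)

lemma mem_swap_image: "z \<in> prod.swap ` A \<longleftrightarrow> prod.swap z \<in> A"
  by (metis image_iff swap_swap)

context carpet
begin

text \<open>The reflection exchanges rows and columns, so results about rows also yield those about
  columns.\<close>

lemma carpet_swap: "carpet N (prod.swap ` D) (prod.swap ` F)"
proof
  show "x \<in> prod.swap ` F \<longleftrightarrow> (\<exists>d\<in>prod.swap ` D. of_int N *\<^sub>R x - emb d \<in> prod.swap ` F)" for x
    using F_iff[of "prod.swap x"]
    by (simp add: mem_swap_image swap_diff emb_swap) (simp add: prod.swap_def emb_def)
qed (use N_ge_2 D_sub F_sub in auto)

interpretation sw: carpet N "prod.swap ` D" "prod.swap ` F"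
  by (rule carpet_swap)

lemma digs_swap: "z \<in> sw.digs n \<longleftrightarrow> prod.swap z \<in> digs n"
  by (induction n arbitrary: z)
    (simp_all add: pdiv_def pmod_def mem_swap_image prod_eq_iff conj_commute)

lemma around_swap: "z \<in> sw.around n X \<longleftrightarrow> prod.swap z \<in> around n (prod.swap X)"
  by (simp add: sw.around_def around_def digs_swap mem_swap_image swap_diff emb_swap)

lemma thin_swap: "sw.thin d \<longleftrightarrow> thin (prod.swap d)"
  unfolding sw.thin_def thin_def
  by (simp add: mem_swap_image swap_diff emb_swap) (metis swap_swap swap_diff)

lemma splitting_swap:
  "sw.splitting n X I J \<longleftrightarrow> splitting n (prod.swap X) (prod.swap ` I) (prod.swap ` J)"
proof -
  have "I \<union> J = sw.around n X \<longleftrightarrow> prod.swap ` I \<union> prod.swap ` J = around n (prod.swap X)"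
    unfolding set_eq_iff by (simp add: around_swap mem_swap_image) (metis swap_swap)
  moreover have "I \<inter> J = {} \<longleftrightarrow> prod.swap ` I \<inter> prod.swap ` J = {}"
    unfolding set_eq_iff by (simp add: mem_swap_image) (metis swap_swap)
  ultimately show ?thesis
    unfolding sw.splitting_def splitting_def by (auto simp: thin_swap swap_diff)
qed

lemma splitting_reduce:
  assumes sp: "splitting (Suc (Suc m)) X I J" and m: "m \<ge> 1"
  shows "\<exists>n Y I' J'. n \<in> {2, Suc m} \<and> splitting n Y I' J'"
proof (cases "(\<exists>i. fst X = of_int (N * i)) \<and> (\<exists>j. snd X = of_int (N * j))")
  case True
  then obtain i j where X: "fst X = of_int (N * i)" "snd X = of_int (N * j)" by blast
  \<comment> \<open>At a corner of the parent grid each coordinate of a cell is \<open>N * i\<close>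
    or \<open>N * i - 1\<close>, with quotient \<open>i\<close> or \<open>i - 1\<close>; passing to
    parents thus preserves differences.\<close>
  have *: "a div N - b div N = a - b"
    if "real_of_int a \<le> of_int (N * i)" "of_int (N * i) \<le> real_of_int a + 1"
      "real_of_int b \<le> of_int (N * i)" "of_int (N * i) \<le> real_of_int b + 1" for a b i
  proof -
    have "(N * i - 1) div N = i - 1"
      using int_div_pos_eq[of "N * i - 1" N "i - 1" "N - 1"] N_ge_2 by (simp add: algebra_simps)
    moreover have "a \<le> N * i" "N * i \<le> a + 1" "b \<le> N * i" "N * i \<le> b + 1" using that by linarith+
    hence "(a = N * i \<or> a = N * i - 1) \<and> (b = N * i \<or> b = N * i - 1)" by linarith
    ultimately show ?thesis using N_ge_2 by auto
  qed
  have "pdiv v N - pdiv w N = v - w" if "w \<in> I" "v \<in> J" for w v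
  proof -
    have W: "w \<in> around (Suc (Suc m)) X" "v \<in> around (Suc (Suc m)) X"
      using sp that by (auto simp: splitting_def)
    show ?thesis
      using around_bounds[OF W(1)] around_bounds[OF W(2)] *[of "fst v" i "fst w"] *[of "snd v" j "snd w"]
      unfolding X by (simp add: pdiv_def prod_eq_iff)
  qed
  from splitting_truncate[OF sp this] show ?thesis by blast
next
  case False
  show ?thesis
  proof (cases "\<exists>j. snd X = of_int (N * j)")
    case True
    \<comment> \<open>Here only the first coordinate is off the parent grid, so the row argument is
      applied to the reflected carpet.\<close>
    have "sw.splitting (Suc (Suc m)) (prod.swap X) (prod.swap ` I) (prod.swap ` J)"
      using sp by (simp add: splitting_swap image_comp)
    from sw.splitting_reduce_row[OF this m] True False
    obtain n Y I' J' where "n \<in> {2, Suc m}" "sw.splitting n Y I' J'"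
      by (metis snd_swap)
    thus ?thesis unfolding splitting_swap by blast
  next
    case False
    then show ?thesis using splitting_reduce_row[OF sp m] by blast
  qed
qed

text \<open>From a level \<open>n\<close> at least 3 the reduction leads to level 2 or to
  \<open>n - 1\<close>. Level 0 has just one cell, which cannot be split.\<close>

lemma splitting_level_1_or_2:
  "splitting n X I J \<Longrightarrow> \<exists>k Y I' J'. k \<in> {1, 2} \<and> splitting k Y I' J'"
proof (induction n arbitrary: X I J rule: less_induct)
  case (less n)
  show ?case
  proof (cases "n \<ge> 3")
    case True
    then obtain m where m: "n = Suc (Suc m)" "m \<ge> 1"
      by (intro that[of "n - 2"]) auto
    from splitting_reduce[OF less.prems[unfolded m(1)] m(2)]
    obtain k Y I' J' where k: "k = 2 \<or> k = Suc m" and sp: "splitting k Y I' J'"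
      by blast
    show ?thesis
      using k
    proof
      assume "k = 2"
      with sp show ?thesis by blast
    next
      assume "k = Suc m"
      with less.IH[OF _ sp] m(1) show ?thesis by simp
    qed
  next
    case False
    then have "n = 0 \<or> n \<in> {1, 2}" by auto
    with less.prems not_splitting_0 show ?thesis by blast
  qed
qed

end

section \<open>Cells as planar sets, and splittings from local cut points\<close>

context carpet
begin

definition cell :: "nat \<Rightarrow> int \<times> int \<Rightarrow> (real \<times> real) set" where
  "cell n p = {z. of_int (N ^ n) *\<^sub>R z - emb p \<in> F}"

lemma cell_eq_image: "cell n p = (\<lambda>z. (1 / of_int (N ^ n)) *\<^sub>R (z + emb p)) ` F"
proof (intro equalityI subsetI)
  fix z assume "z \<in> cell n p"
  moreover have "z = (1 / of_int (N ^ n)) *\<^sub>R ((of_int (N ^ n) *\<^sub>R z - emb p) + emb p)"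
    using N_ge_2 by simp
  ultimately show "z \<in> (\<lambda>z. (1 / of_int (N ^ n)) *\<^sub>R (z + emb p)) ` F"
    unfolding cell_def by blast
qed (use N_ge_2 in \<open>auto simp: cell_def\<close>)

lemma cell_minus_eq_image:
  "cell n p - {x} = (\<lambda>z. (1 / of_int (N ^ n)) *\<^sub>R (z + emb p)) ` (F - {of_int (N ^ n) *\<^sub>R x - emb p})"
  using N_ge_2 unfolding cell_eq_image by auto

lemma mem_cell_iff: "x \<in> cell n p \<longleftrightarrow> of_int (N ^ n) *\<^sub>R x - emb p \<in> F"
  by (simp add: cell_def)

lemma around_iff: "around n (of_int (N ^ n) *\<^sub>R x) = {p \<in> digs n. x \<in> cell n p}"
  by (simp add: around_def cell_def)

lemma F_eq_cells: "F = (\<Union>p\<in>digs n. cell n p)"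
  using mem_scaled scaled_mem by (auto simp: cell_def)

lemma finite_digs: "finite (digs n)"
proof (rule finite_subset)
  show "digs n \<subseteq> {0..<N ^ n} \<times> {0..<N ^ n}" using digs_bounds by fastforce
qed simp

lemma compact_cell: "compact F \<Longrightarrow> compact (cell n p)"
  unfolding cell_eq_image by (intro compact_continuous_image continuous_intros)

text \<open>The cells missing \<open>x\<close> are finitely many compact sets, so the complement of
  their union is open.\<close>

lemma cell_nbhd:
  assumes "compact F"
  shows "\<exists>V. open V \<and> x \<in> V \<and> V \<inter> F \<subseteq> (\<Union>p\<in>around n (of_int (N ^ n) *\<^sub>R x). cell n p)"
proof -
  define C where "C = (\<Union>p\<in>digs n - around n (of_int (N ^ n) *\<^sub>R x). cell n p)"
  have "closed C" unfolding C_def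
    using finite_digs compact_cell[OF assms] by (intro closed_UN) (auto intro: compact_imp_closed)
  moreover have "x \<notin> C" using around_iff[of n x] by (auto simp: C_def simp del: of_int_power)
  moreover have "- C \<inter> F \<subseteq> (\<Union>p\<in>around n (of_int (N ^ n) *\<^sub>R x). cell n p)"
  proof
    fix z assume z: "z \<in> - C \<inter> F"
    then obtain p where "p \<in> digs n" "z \<in> cell n p" using F_eq_cells[of n] by blast
    with z show "z \<in> (\<Union>p\<in>around n (of_int (N ^ n) *\<^sub>R x). cell n p)"
      unfolding C_def by blast
  qed
  ultimately show ?thesis by (intro exI[of _ "- C"]) (auto simp: open_Compl)
qed

lemma dist_cell:
  assumes "x \<in> cell n p" "z \<in> cell n p" shows "dist z x \<le> 2 / of_int (N ^ n)"
proof -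
  have pos: "real_of_int (N ^ n) > 0" using N_ge_2 by simp
  have *: "\<bar>a - b\<bar> \<le> 1 / of_int (N ^ n)"
    if "0 \<le> of_int (N ^ n) * a - c" "of_int (N ^ n) * a - c \<le> 1"
      "0 \<le> of_int (N ^ n) * b - c" "of_int (N ^ n) * b - c \<le> 1" for a b c :: real
  proof -
    have "\<bar>of_int (N ^ n) * (a - b)\<bar> \<le> 1" using that by (simp add: algebra_simps)
    hence "of_int (N ^ n) * \<bar>a - b\<bar> \<le> 1" using pos by (simp add: abs_mult)
    thus ?thesis using pos by (simp add: field_simps)
  qed
  have "dist z x \<le> \<bar>fst z - fst x\<bar> + \<bar>snd z - snd x\<bar>"
    using sqrt_sum_squares_le_sum_abs[of "fst z - fst x" "snd z - snd x"]
    by (simp add: dist_prod_def dist_real_def)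
  also have "\<dots> \<le> 1 / of_int (N ^ n) + 1 / of_int (N ^ n)"
    using F_bounds[OF assms(1)[unfolded mem_cell_iff]] F_bounds[OF assms(2)[unfolded mem_cell_iff]]
    by (intro add_mono *[of _ "of_int (fst p)"] *[of _ "of_int (snd p)"]) auto
  finally show ?thesis by simp
qed

lemma exists_small_cells:
  assumes "e > 0" shows "\<exists>n. 2 / real_of_int (N ^ n) < e"
proof -
  have "(\<lambda>n. 2 * (1 / real_of_int N) ^ n) \<longlonglongrightarrow> 2 * 0"
    using N_ge_2 by (intro tendsto_intros LIMSEQ_power_zero) simp
  hence "\<forall>\<^sub>F n in sequentially. 2 * (1 / real_of_int N) ^ n < e"
    using assms by (intro order_tendstoD(2)) auto
  then obtain n where "2 * (1 / real_of_int N) ^ n < e"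
    by (auto simp: eventually_sequentially)
  thus ?thesis by (intro exI[of _ n]) (simp add: power_divide)
qed

text \<open>If every cell at \<open>x\<close> avoided \<open>A\<close>, then \<open>x\<close> would not be in the closure of \<open>A\<close>, and adding
  \<open>x\<close> to \<open>B\<close> would disconnect \<open>U\<close> itself.\<close>
lemma cells_meet_both_sides:
  assumes "compact F" "connected U" "U \<subseteq> F" "x \<in> U"
    and sep: "open A" "open B" "A \<inter> B \<inter> (U - {x}) = {}" "U - {x} \<subseteq> A \<union> B" "A \<inter> (U - {x}) \<noteq> {}"
    and sub: "\<And>p. p \<in> around n (of_int (N ^ n) *\<^sub>R x) \<Longrightarrow> cell n p \<subseteq> U"
  shows "\<exists>p\<in>around n (of_int (N ^ n) *\<^sub>R x). \<not> cell n p - {x} \<subseteq> B"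
proof (rule ccontr)
  assume no: "\<not> ?thesis"
  obtain V where V: "open V" "x \<in> V" "V \<inter> F \<subseteq> (\<Union>p\<in>around n (of_int (N ^ n) *\<^sub>R x). cell n p)"
    using cell_nbhd[OF assms(1)] by blast
  have VB: "V \<inter> U \<subseteq> insert x B" using V(3) no assms(3) by fast
  have "open (A - {x})" "open (B \<union> V)" using sep V by auto
  moreover have "(A - {x}) \<inter> (B \<union> V) \<inter> U = {}" using VB sep(3) by blast
  moreover have "U \<subseteq> (A - {x}) \<union> (B \<union> V)" using sep(4) V(2) by blast
  moreover have "(A - {x}) \<inter> U \<noteq> {}" "(B \<union> V) \<inter> U \<noteq> {}" using sep(5) V(2) assms(4) by blast+
  ultimately show False using assms(2) unfolding connected_def by blast
qed

lemma local_cut_point_imp_splitting: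
  assumes "compact F" and conn: "connected F" and nocut: "\<not> (\<exists>x. cut_point F x)"
    and nontriv: "\<And>x. F - {x} \<noteq> {}" and "local_cut_point F x"
  shows "\<exists>n X I J. splitting n X I J"
proof -
  obtain U V where U: "U \<subseteq> F" "open V" "x \<in> V" "V \<inter> F \<subseteq> U" "cut_point U x"
    using assms(5) unfolding local_cut_point_def by blast
  then have cU: "connected U" "x \<in> U" "\<not> connected (U - {x})" by (auto simp: cut_point_def)
  then obtain A B where AB: "open A" "open B" "A \<inter> B \<inter> (U - {x}) = {}" "U - {x} \<subseteq> A \<union> B"
      "A \<inter> (U - {x}) \<noteq> {}" "B \<inter> (U - {x}) \<noteq> {}"
    unfolding connected_def by blast
  obtain e where e: "e > 0" "ball x e \<subseteq> V" using U(2,3) openE by blast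
  \<comment> \<open>By the diameter bound of \<open>dist_cell\<close>, all cells at \<open>x\<close>
    then lie in the ball inside \<open>V\<close>, hence in \<open>U\<close>.\<close>
  obtain n where n: "2 / real_of_int (N ^ n) < e" using exists_small_cells[OF e(1)] by blast
  let ?X = "of_int (N ^ n) *\<^sub>R x"
  let ?W = "around n ?X"
  have sub: "cell n p \<subseteq> U" if "p \<in> ?W" for p
  proof
    fix z assume z: "z \<in> cell n p"
    have p: "p \<in> digs n" "x \<in> cell n p" using that unfolding around_iff by blast+
    have "z \<in> V" using dist_cell[OF p(2) z] n e(2) by (auto simp: dist_commute subset_eq)
    moreover have "z \<in> F" using F_eq_cells[of n] p(1) z by blast
    ultimately show "z \<in> U" using U(4) by blast
  qed
  have ne: "cell n p - {x} \<noteq> {}" for p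
    unfolding cell_minus_eq_image using nontriv by blast
  \<comment> \<open>Without cut points \<open>F - {y}\<close> is connected, whether or not
    \<open>y\<close> lies in \<open>F\<close>, and a punctured cell is an affine image of such a
    set. Each punctured cell at \<open>x\<close> therefore stays on one side of the
    separation.\<close>
  have con: "connected (cell n p - {x})" for p
  proof -
    have "connected (F - {y})" for y
      using conn nocut unfolding cut_point_def by (metis Diff_empty Diff_insert0)
    thus ?thesis unfolding cell_minus_eq_image
      by (intro connected_continuous_image continuous_intros)
  qed
  define I where "I = {p \<in> ?W. cell n p - {x} \<subseteq> A}"
  define J where "J = {p \<in> ?W. cell n p - {x} \<subseteq> B}"
  have side: "cell n p - {x} \<subseteq> A \<or> cell n p - {x} \<subseteq> B" if "p \<in> ?W" for p
  proof -
    have "cell n p - {x} \<subseteq> U - {x}" using sub[OF that] by blast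
    thus ?thesis using connectedD[OF con[of p] AB(1,2)] AB(3,4) by blast
  qed
  have "\<exists>p\<in>?W. \<not> cell n p - {x} \<subseteq> B"
    by (rule cells_meet_both_sides[OF assms(1) cU(1) U(1) cU(2) AB(1-5) sub])
  hence "I \<noteq> {}" using side unfolding I_def by blast
  moreover have "\<exists>p\<in>?W. \<not> cell n p - {x} \<subseteq> A"
    by (rule cells_meet_both_sides[OF assms(1) cU(1) U(1) cU(2) AB(2,1) _ _ AB(6) sub])
      (use AB(3,4) in blast)+
  hence "J \<noteq> {}" using side unfolding J_def by blast
  moreover have "I \<union> J = ?W" using side by (auto simp: I_def J_def)
  moreover have "I \<inter> J = {}" using AB(3) sub ne unfolding I_def J_def by blast
  moreover have "thin (v - w)" if wv: "w \<in> I" "v \<in> J" for w v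
  proof -
    have single: "y = x" if "y \<in> cell n w" "y \<in> cell n v" for y
      using that wv AB(3) sub unfolding I_def J_def by blast
    have "z = ?X - emb w" if "z \<in> F" "z - emb (v - w) \<in> F" for z
    proof -
      \<comment> \<open>The similarity of the cell \<open>w\<close> carries \<open>z\<close> to a
        common point of the cells \<open>w\<close> and \<open>v\<close>, which can only be
        \<open>x\<close>.\<close>
      define y where "y = (1 / of_int (N ^ n)) *\<^sub>R (z + emb w)"
      have y: "of_int (N ^ n) *\<^sub>R y = z + emb w" using N_ge_2 by (simp add: y_def)
      have "y \<in> cell n w" "y \<in> cell n v"
        using that y by (simp_all add: mem_cell_iff emb_diff algebra_simps)
      from single[OF this] y show ?thesis by (simp add: algebra_simps)
    qed
    thus ?thesis unfolding thin_def by blast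
  qed
  ultimately have "splitting n ?X I J" by (simp add: splitting_def)
  thus ?thesis by blast
qed

end

section \<open>From words and similarities to integer positions\<close>

lemma is_GSC_imp_unit_square:
  assumes "is_GSC N D F" shows "F \<subseteq> {0..1} \<times> {0..1}"
proof -
  have N: "N \<ge> 2" and D: "D \<subseteq> {0..<N} \<times> {0..<N}" and F: "compact F" "F = (\<Union>i\<in>D. gsc_map N i ` F)"
    using assms by (auto simp: is_GSC_def)
  \<comment> \<open>A maximum principle for a coordinate \<open>f\<close> with digit
    \<open>g\<close>: at a maximum \<open>a\<close>, self-similarity gives
    \<open>N * f a \<le> f a + (N - 1)\<close>, so \<open>f a \<le> 1\<close>. A minimum gives the
    lower bound in the same way.\<close>
  have *: "0 \<le> f x \<and> f x \<le> 1"
    if f: "continuous_on F f" "\<And>i z. f (gsc_map N i z) = (f z + real (g i)) / real N"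
      and g: "\<And>i. i \<in> D \<Longrightarrow> g i < N" and x: "x \<in> F"
    for f :: "real \<times> real \<Rightarrow> real" and g :: "nat \<times> nat \<Rightarrow> nat" and x
  proof -
    have "F \<noteq> {}" using x by auto
    obtain a where a: "a \<in> F" "\<And>y. y \<in> F \<Longrightarrow> f y \<le> f a"
      using continuous_attains_sup[OF F(1) \<open>F \<noteq> {}\<close> f(1)] by blast
    obtain b where b: "b \<in> F" "\<And>y. y \<in> F \<Longrightarrow> f b \<le> f y"
      using continuous_attains_inf[OF F(1) \<open>F \<noteq> {}\<close> f(1)] by blast
    obtain i a' where a': "i \<in> D" "a' \<in> F" "a = gsc_map N i a'" using a(1) F(2) by blast
    have "real N * f a = f a' + real (g i)" using f(2)[of i a'] a'(3) N by simp
    also have "\<dots> \<le> f a + (real N - 1)" using a(2)[OF a'(2)] g[OF a'(1)] by linarith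
    finally have "(real N - 1) * f a \<le> (real N - 1) * 1" by (simp add: algebra_simps)
    hence "f a \<le> 1" using N by (simp add: mult_le_cancel_left_pos)
    obtain j b' where b': "j \<in> D" "b' \<in> F" "b = gsc_map N j b'" using b(1) F(2) by blast
    have "real N * f b = f b' + real (g j)" using f(2)[of j b'] b'(3) N by simp
    hence "0 \<le> (real N - 1) * f b" using b(2)[OF b'(2)] by (simp add: algebra_simps)
    hence "0 \<le> f b" using N by (simp add: zero_le_mult_iff)
    thus ?thesis using \<open>f a \<le> 1\<close> a(2)[OF x] b(2)[OF x] by linarith
  qed
  show ?thesis
  proof
    fix x assume x: "x \<in> F"
    have "0 \<le> fst x \<and> fst x \<le> 1" using D x
      by (intro *[of fst fst]) (auto simp: gsc_map_def intro!: continuous_intros)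
    moreover have "0 \<le> snd x \<and> snd x \<le> 1" using D x
      by (intro *[of snd snd]) (auto simp: gsc_map_def intro!: continuous_intros)
    ultimately show "x \<in> {0..1} \<times> {0..1}" by (cases x) auto
  qed
qed

abbreviation int_pair :: "nat \<times> nat \<Rightarrow> int \<times> int" where
  "int_pair \<equiv> map_prod int int"

lemma gsc_map_eq_iff:
  assumes "N > 0"
  shows "x = gsc_map N d y \<longleftrightarrow> y = real N *\<^sub>R x - emb (int_pair d)"
  using assms by (auto simp: gsc_map_def prod_eq_iff field_simps)

lemma mem_gsc_map_image_iff:
  assumes "N > 0"
  shows "x \<in> gsc_map N d ` A \<longleftrightarrow> real N *\<^sub>R x - emb (int_pair d) \<in> A"
  unfolding image_iff gsc_map_eq_iff[OF assms] by blast

lemma is_GSC_imp_carpet: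
  assumes "is_GSC N D F" shows "carpet (int N) (int_pair ` D) F"
proof
  have N: "N \<ge> 2" and F: "F = (\<Union>i\<in>D. gsc_map N i ` F)"
    using assms by (auto simp: is_GSC_def)
  show "x \<in> F \<longleftrightarrow> (\<exists>d\<in>int_pair ` D. of_int (int N) *\<^sub>R x - emb d \<in> F)" for x
    using N by (subst F) (simp add: mem_gsc_map_image_iff)
  show "F \<subseteq> {0..1} \<times> {0..1}" by (rule is_GSC_imp_unit_square[OF assms])
qed (use assms in \<open>auto simp: is_GSC_def\<close>)

text \<open>A word read as a pair of base \<open>N\<close> numerals, first letter most significant:
  the position of its cell.\<close>

fun pos :: "nat \<Rightarrow> (nat \<times> nat) list \<Rightarrow> int \<times> int" where
  "pos N [] = 0"
| "pos N (i # w) =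
    (int N ^ length w * int (fst i) + fst (pos N w), int N ^ length w * int (snd i) + snd (pos N w))"

lemma mem_gsc_word_image_iff:
  assumes "N > 0"
  shows "x \<in> gsc_word N w ` A \<longleftrightarrow> real N ^ length w *\<^sub>R x - emb (pos N w) \<in> A"
proof (induction w arbitrary: x)
  case Nil
  show ?case by (simp add: emb_def zero_prod_def [symmetric])
next
  case (Cons i w)
  have "real N ^ length w *\<^sub>R (real N *\<^sub>R x - emb (int_pair i)) - emb (pos N w) =
      real N ^ length (i # w) *\<^sub>R x - emb (pos N (i # w))"
    by (simp add: prod_eq_iff algebra_simps)
  then show ?case
    using Cons.IH[of "real N *\<^sub>R x - emb (int_pair i)"] mem_gsc_map_image_iff[OF assms, of x i]
    by (simp only: gsc_word.simps image_comp [symmetric])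
qed

lemma words_Suc: "words D (Suc n) = {i # w | i w. i \<in> D \<and> w \<in> words D n}"
  by (auto simp: words_def length_Suc_conv)

text \<open>Words grow at the front, so the induction runs through \<open>digs_Suc_front\<close> and
  not through the defining recursion of \<open>digs\<close>.\<close>

lemma pos_image_words:
  assumes "carpet (int N) (int_pair ` D) F"
  shows "pos N ` words D n = carpet.digs (int N) (int_pair ` D) n"
proof -
  interpret carpet "int N" "int_pair ` D" F by (rule assms)
  show ?thesis
  proof (induction n)
    case 0
    show ?case by (auto simp: words_def)
  next
    case (Suc n)
    show ?case
    proof (intro equalityI subsetI)
      fix z assume "z \<in> pos N ` words D (Suc n)"
      then obtain i w where iw: "i \<in> D" "w \<in> words D n" "z = pos N (i # w)"
        by (auto simp: words_Suc)
      have w: "pos N w \<in> digs n" using Suc iw(2) by blast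
      have "length w = n" using iw(2) by (simp add: words_def)
      moreover have "int N ^ n \<noteq> 0" using N_ge_2 by simp
      ultimately have "pdiv z (int N ^ n) = int_pair i" "pmod z (int N ^ n) = pos N w"
        using digs_bounds[OF w] by (simp_all add: iw(3) pdiv_def pmod_def prod_eq_iff)
      thus "z \<in> digs (Suc n)" using iw(1) w digs_Suc_front[of z n] by simp
    next
      fix z assume "z \<in> digs (Suc n)"
      hence z: "pdiv z (int N ^ n) \<in> int_pair ` D" "pmod z (int N ^ n) \<in> digs n"
        using digs_Suc_front[of z n] by (simp_all del: digs.simps)
      obtain i where i: "i \<in> D" "pdiv z (int N ^ n) = int_pair i" using z(1) by (metis imageE)
      obtain w where w: "w \<in> words D n" "pmod z (int N ^ n) = pos N w"
        using z(2) unfolding Suc [symmetric] by (metis imageE)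
      have "length w = n" using w(1) by (simp add: words_def)
      hence z_eq: "z = pos N (i # w)"
        using i(2) w(2) mult_div_mod_eq[of "int N ^ n" "fst z"] mult_div_mod_eq[of "int N ^ n" "snd z"]
        by (simp add: pdiv_def pmod_def prod_eq_iff)
      show "z \<in> pos N ` words D (Suc n)"
        unfolding z_eq words_Suc using i(1) w(1) by blast
    qed
  qed
qed

section \<open>The equivalence in terms of words\<close>

theorem mainTheorem2:
  fixes N :: nat and D :: "(nat \<times> nat) set" and F :: "(real \<times> real) set"
  assumes "is_GSC N D F"
    and "connected F"
    and "\<not> (\<exists>x. cut_point F x)"
  shows "(\<exists>x. local_cut_point F x) \<longleftrightarrow>
    (\<exists>n::nat. n \<in> {1, 2} \<and> (\<exists>I J x. I \<subseteq> words D n \<and> J \<subseteq> words D n \<and> I \<inter> J = {} \<and>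
        (\<Union>w\<in>I. gsc_word N w ` F) \<inter> (\<Union>w\<in>J. gsc_word N w ` F) = {x} \<and>
        I \<union> J = {w \<in> words D n. x \<in> gsc_word N w ` F}))"
proof -
  have C: "carpet (int N) (int_pair ` D) F" by (rule is_GSC_imp_carpet[OF assms(1)])
  interpret carpet "int N" "int_pair ` D" F by (rule C)
  have N: "N \<ge> 2" and "card D > 1" and F: "compact F" "F \<noteq> {}" "F = (\<Union>i\<in>D. gsc_map N i ` F)"
    using assms(1) by (auto simp: is_GSC_def)
  \<comment> \<open>A single point would be fixed by every map \<open>gsc_map N d\<close>, but a
    fixed point determines its digit \<open>d\<close>, and \<open>D\<close> has more than one
    element.\<close>
  have nontriv: "F - {x} \<noteq> {}" for x
  proof
    assume "F - {x} = {}"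
    with F(2) have Fx: "F = {x}" by blast
    have "int_pair d = int_pair d'" if "d \<in> D" "d' \<in> D" for d d'
    proof -
      have "gsc_map N d x = x" "gsc_map N d' x = x" using F(3) that unfolding Fx by auto
      hence "real N *\<^sub>R x - emb (int_pair d) = real N *\<^sub>R x - emb (int_pair d')"
        using gsc_map_eq_iff[of N x d x] gsc_map_eq_iff[of N x d' x] N by auto
      thus ?thesis by (simp add: emb_def prod_eq_iff)
    qed
    moreover have "inj int_pair" by (simp add: inj_of_nat prod.inj_map)
    ultimately have "d = d'" if "d \<in> D" "d' \<in> D" for d d'
      using that by (blast dest: injD)
    moreover have "finite D" using \<open>card D > 1\<close> by (intro card_ge_0_finite) simp
    ultimately have "card D \<le> 1" by (simp add: card_le_Suc0_iff_eq)
    with \<open>card D > 1\<close> show False by simp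
  qed
  have cell: "gsc_word N w ` F = cell n (pos N w)" if "w \<in> words D n" for w n
  proof -
    have "length w = n" using that by (simp add: words_def)
    thus ?thesis using mem_gsc_word_image_iff[of N _ w F] N by (auto simp: cell_def)
  qed
  show ?thesis (is "_ \<longleftrightarrow> ?R")
  proof
    assume "\<exists>x. local_cut_point F x"
    then obtain n X I J where n: "n \<in> {1, 2}" and sp: "splitting n X I J"
      using local_cut_point_imp_splitting[OF F(1) assms(2,3) nontriv] splitting_level_1_or_2 by metis
    define x where "x = (1 / of_int (int N ^ n)) *\<^sub>R X"
    have X: "X = of_int (int N ^ n) *\<^sub>R x" using N by (simp add: x_def)
    \<comment> \<open>The classes of positions are pulled back to words along \<open>pos\<close>; by
      \<open>pos_image_words\<close> this leaves the unions of cells unchanged.\<close>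
    define I' where "I' = {w \<in> words D n. pos N w \<in> I}"
    define J' where "J' = {w \<in> words D n. pos N w \<in> J}"
    have IJ: "I \<union> J = {p \<in> digs n. x \<in> cell n p}"
      using sp unfolding splitting_def X around_iff by blast
    have im: "(\<Union>w\<in>{w \<in> words D n. pos N w \<in> K}. gsc_word N w ` F) = (\<Union>p\<in>K. cell n p)"
      if "K \<subseteq> digs n" for K
      using that cell unfolding pos_image_words[OF C, symmetric] by fastforce
    have "(\<Union>p\<in>I. cell n p) \<inter> (\<Union>p\<in>J. cell n p) = {x}"
    proof (intro equalityI subsetI)
      fix y assume "y \<in> (\<Union>p\<in>I. cell n p) \<inter> (\<Union>p\<in>J. cell n p)"
      then obtain w v where wv: "w \<in> I" "v \<in> J" "y \<in> cell n w" "y \<in> cell n v" by blast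
      then have "x \<in> cell n w" "x \<in> cell n v" "thin (v - w)"
        using IJ sp by (auto simp: splitting_def)
      with wv have "of_int (int N ^ n) *\<^sub>R y = of_int (int N ^ n) *\<^sub>R x"
        unfolding mem_cell_iff by (metis thin_scaled)
      thus "y \<in> {x}" using N by simp
    qed (use sp IJ in \<open>auto simp: splitting_def\<close>)
    moreover have "I \<subseteq> digs n" "J \<subseteq> digs n" using IJ by auto
    ultimately have "(\<Union>w\<in>I'. gsc_word N w ` F) \<inter> (\<Union>w\<in>J'. gsc_word N w ` F) = {x}"
      unfolding I'_def J'_def by (simp add: im)
    moreover have "I' \<union> J' = {w \<in> words D n. x \<in> gsc_word N w ` F}"
    proof -
      have "I' \<union> J' = {w \<in> words D n. pos N w \<in> I \<union> J}" by (auto simp: I'_def J'_def)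
      also have "\<dots> = {w \<in> words D n. x \<in> gsc_word N w ` F}"
        unfolding IJ pos_image_words[OF C, symmetric] using cell by auto
      finally show ?thesis .
    qed
    moreover have "I' \<inter> J' = {}" using sp by (auto simp: splitting_def I'_def J'_def)
    moreover have "I' \<subseteq> words D n" "J' \<subseteq> words D n" by (auto simp: I'_def J'_def)
    ultimately show ?R using n by blast
  next
    assume ?R
    then obtain n I J x where IJ: "I \<subseteq> words D n" "J \<subseteq> words D n"
      "(\<Union>w\<in>I. gsc_word N w ` F) \<inter> (\<Union>w\<in>J. gsc_word N w ` F) = {x}"
      "I \<union> J = {w \<in> words D n. x \<in> gsc_word N w ` F}" by blast
    \<comment> \<open>The neighbourhood for the converse is \<open>A \<union> B\<close>: it is
      connected since all its cells contain \<open>x\<close>, and removing \<open>x\<close> leaves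
      two disjoint relatively closed parts, nonempty because no cell is a single point.\<close>
    define A where "A = (\<Union>w\<in>I. gsc_word N w ` F)"
    define B where "B = (\<Union>w\<in>J. gsc_word N w ` F)"
    have fin: "finite (words D n)"
    proof -
      have "finite D" using \<open>card D > 1\<close> by (metis card.infinite not_one_less_zero)
      from finite_lists_length_eq[OF this, of n] show ?thesis
        by (simp add: words_def conj_commute)
    qed
    have closed: "closed (\<Union>w\<in>K. gsc_word N w ` F)" if "K \<subseteq> words D n" for K
    proof (intro closed_UN ballI)
      fix w assume "w \<in> K"
      with that have "gsc_word N w ` F = cell n (pos N w)" by (intro cell) blast
      thus "closed (gsc_word N w ` F)" by (simp add: compact_cell[OF F(1)] compact_imp_closed)
    qed (rule finite_subset[OF that fin])
    have AB: "A \<inter> B = {x}" "closed A" "closed B" using IJ closed by (simp_all add: A_def B_def)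
    have F_sub: "gsc_word N w ` F \<subseteq> F" if "w \<in> words D n" for w
      using that cell[OF that] F_eq_cells[of n] pos_image_words[OF C, of n] by blast
    have "x \<in> F" using IJ F_sub by blast
    have big: "\<not> gsc_word N w ` F \<subseteq> {x}" if "w \<in> words D n" for w
      using nontriv cell_minus_eq_image[of n "pos N w" x] cell[OF that] by blast
    obtain V where V: "open V" "x \<in> V"
        "V \<inter> F \<subseteq> (\<Union>p\<in>around n (of_int (int N ^ n) *\<^sub>R x). cell n p)"
      using cell_nbhd[OF F(1)] by blast
    have "V \<inter> F \<subseteq> A \<union> B"
    proof
      fix z assume "z \<in> V \<inter> F"
      then obtain p where p: "p \<in> digs n" "x \<in> cell n p" "z \<in> cell n p"
        using V(3) unfolding around_iff by blast
      then obtain w where w: "w \<in> words D n" "p = pos N w"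
        using pos_image_words[OF C, of n] by blast
      with p have "w \<in> I \<union> J" "z \<in> gsc_word N w ` F" by (simp_all add: IJ(4) cell)
      thus "z \<in> A \<union> B" by (auto simp: A_def B_def)
    qed
    moreover have "A \<union> B \<subseteq> F" using IJ(1,2) F_sub by (fastforce simp: A_def B_def)
    moreover have "connected (A \<union> B)"
    proof -
      have "connected (gsc_word N w ` F)" if "w \<in> words D n" for w
        unfolding cell[OF that] cell_eq_image
        by (intro connected_continuous_image continuous_intros assms(2))
      moreover have "A \<union> B = (\<Union>w\<in>I \<union> J. gsc_word N w ` F)" by (auto simp: A_def B_def)
      ultimately show ?thesis using IJ(4)
        by (auto intro!: connected_Union)
    qed
    moreover have "\<not> connected (A \<union> B - {x})"
    proof -
      obtain w v where "w \<in> I" "v \<in> J" using IJ(3) by blast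
      hence "gsc_word N w ` F \<subseteq> A" "gsc_word N v ` F \<subseteq> B"
          "\<not> gsc_word N w ` F \<subseteq> {x}" "\<not> gsc_word N v ` F \<subseteq> {x}"
        using big IJ(1,2) by (auto simp only: A_def B_def subset_eq)
      hence "A \<inter> (A \<union> B - {x}) \<noteq> {}" "B \<inter> (A \<union> B - {x}) \<noteq> {}" by fast+
      moreover have "A \<inter> B \<inter> (A \<union> B - {x}) = {}" "A \<union> B - {x} \<subseteq> A \<union> B" using AB(1) by auto
      ultimately show ?thesis unfolding connected_closed using AB(2,3) by blast
    qed
    ultimately have "local_cut_point F x"
      unfolding local_cut_point_def cut_point_def using V(1,2) AB(1) \<open>x \<in> F\<close>
      by (intro conjI exI[of _ "A \<union> B"] exI[of _ V]) auto
    thus "\<exists>x. local_cut_point F x" by blast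
  qed
qed

end
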